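(* Let $F(x)=\frac{x}{1+x}$. For every reduced fraction $x\in[0,1]$ and every $k\ge5$, $$P\big(k+1,F(x)\big)=\frac{1}{1+x}\,P(k,x).$$
   Context: Farey binary tree: $\ell_1=\{0/1,1/1\}$, $\ell_{n+1}$ = mediants $\frac{p+p'}{q+q'}$ of pairs $p/q<p'/q'$ adjacent in $\bigcup_{i\le n}\ell_i$; each reduced $p/q\in(0,1)$ is the mediant of a unique adjacent pair $p_1/q_1<p_2/q_2$ (its parents). Haros graphs: $G_0$ has two nodes joined by an edge. For ordered-node graphs $G$ ($v_1,\dots,v_a$) and $G'$ ($w_1,\dots,w_b$), $G\oplus G'$ has nodes $u_1,\dots,u_{a+b-1}$ obtained by identifying $v_a$ with $w_1$, keeping all edges, and adding an edge $u_1u_{a+b-1}$. $G_{0/1}=G_{1/1}=G_0$, $G_{p/q}=G_{p_1/q_1}\oplus G_{p_2/q_2}$ ($q+1$ nodes). Degree convention: the first and last nodes are identified into one boundary node whose degree is the sum of their degrees, giving $q$ nodes; $P(k,p/q)$ is the fraction of these $q$ nodes having degree $k$. *)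

theory Defs
  imports Complex_Main
begin

definition numer :: "rat \<Rightarrow> int" where "numer x = fst (quotient_of x)"

definition denom :: "rat \<Rightarrow> int" where "denom x = snd (quotient_of x)"

definition mediant :: "rat \<Rightarrow> rat \<Rightarrow> rat" where
  "mediant x y = Fract (numer x + numer y) (denom x + denom y)"

definition adjacent :: "rat set \<Rightarrow> rat \<Rightarrow> rat \<Rightarrow> bool" where
  "adjacent S x y \<longleftrightarrow> x \<in> S \<and> y \<in> S \<and> x < y \<and> (\<forall>z\<in>S. \<not> (x < z \<and> z < y))"

text \<open>Levels are numbered from \<open>1\<close>; level \<open>0\<close> is a dummy.\<close>

fun farey_level :: "nat \<Rightarrow> rat set" where
  "farey_level 0 = {}"
| "farey_level (Suc 0) = {0, 1}"
| "farey_level (Suc (Suc n)) =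
     {mediant x y | x y. adjacent (\<Union>i\<in>{1..Suc n}. farey_level i) x y}"

definition farey_upto :: "nat \<Rightarrow> rat set" where
  "farey_upto n = (\<Union>i\<in>{1..n}. farey_level i)"

definition farey_parents :: "rat \<Rightarrow> rat \<Rightarrow> rat \<Rightarrow> bool" where
  "farey_parents x a b \<longleftrightarrow>
     (\<exists>n\<ge>1. adjacent (farey_upto n) a b) \<and> x = mediant a b"

text \<open>A graph with ordered nodes \<open>1, \<dots>, node_count G\<close>; an edge is a two-element set of nodes.\<close>

record ordered_graph =
  node_count :: nat
  edges :: "nat set set"

definition haros_base :: ordered_graph where
  "haros_base = \<lparr>node_count = 2, edges = {{1, 2}}\<rparr>"

text \<open>Node \<open>j\<close> of the second graph becomes node \<open>j + (node_count G - 1)\<close>, so that its first node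
  is the last node of the first graph.\<close>

definition graph_concat :: "ordered_graph \<Rightarrow> ordered_graph \<Rightarrow> ordered_graph"  (infixl "\<oplus>" 65) where
  "G \<oplus> H =
     \<lparr>node_count = node_count G + node_count H - 1,
      edges = edges G \<union> (\<lambda>e. (\<lambda>j. j + (node_count G - 1)) ` e) ` edges H
              \<union> {{1, node_count G + node_count H - 1}}\<rparr>"

inductive is_haros_graph :: "rat \<Rightarrow> ordered_graph \<Rightarrow> bool" where
  zero: "is_haros_graph 0 haros_base"
| one: "is_haros_graph 1 haros_base"
| mediant: "\<lbrakk>farey_parents x a b; is_haros_graph a G; is_haros_graph b H\<rbrakk>
    \<Longrightarrow> is_haros_graph x (G \<oplus> H)"

definition haros_graph :: "rat \<Rightarrow> ordered_graph" where
  "haros_graph x = (THE G. is_haros_graph x G)"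

definition node_degree :: "ordered_graph \<Rightarrow> nat \<Rightarrow> nat" where
  "node_degree G v = card {e \<in> edges G. v \<in> e}"

text \<open>Identifying the first and the last node leaves the nodes \<open>1, \<dots>, node_count G - 1\<close>, where
  node \<open>1\<close> now stands for the boundary node.\<close>

definition closed_nodes :: "ordered_graph \<Rightarrow> nat set" where
  "closed_nodes G = {1..<node_count G}"

definition closed_degree :: "ordered_graph \<Rightarrow> nat \<Rightarrow> nat" where
  "closed_degree G v =
     (if v = 1 then node_degree G 1 + node_degree G (node_count G) else node_degree G v)"

definition degree_dist :: "nat \<Rightarrow> rat \<Rightarrow> rat" where
  "degree_dist k x =
     of_nat (card {v \<in> closed_nodes (haros_graph x). closed_degree (haros_graph x) v = k})
     / of_nat (card (closed_nodes (haros_graph x)))"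

definition F_map :: "rat \<Rightarrow> rat" where
  "F_map x = x / (1 + x)"

lemma denom_pos: "denom x > 0"
  by (simp add: denom_def quotient_of_denom_pos')

lemma rat_numer_denom: "x = of_int (numer x) / of_int (denom x)"
  using quotient_of_div[of x "numer x" "denom x"] by (simp add: numer_def denom_def)

lemma mediant_eq: "mediant x y = of_int (numer x + numer y) / of_int (denom x + denom y)"
  by (simp only: mediant_def Fract_of_int_quotient)

lemma less_iff_cross: "x < y \<longleftrightarrow> numer x * denom y < numer y * denom x"
proof -
  have "x < y \<longleftrightarrow> (of_int (numer x) / of_int (denom x) :: rat) < of_int (numer y) / of_int (denom y)"
    by (simp flip: rat_numer_denom)
  also have "\<dots> \<longleftrightarrow> (of_int (numer x * denom y) :: rat) < of_int (numer y * denom x)"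
    using denom_pos[of x] denom_pos[of y] by (simp add: field_simps)
  finally show ?thesis by (simp only: of_int_less_iff)
qed

lemma mediant_between:
  assumes "x < y"
  shows "x < mediant x y" "mediant x y < y"
proof -
  have *: "of_int (numer x) * of_int (denom y) < (of_int (numer y) * of_int (denom x) :: rat)"
    using less_iff_cross[THEN iffD1, OF assms] by (simp only: of_int_less_iff flip: of_int_mult)
  have p: "(of_int (denom x) :: rat) > 0" "(of_int (denom y) :: rat) > 0"
    using denom_pos by simp_all
  have "of_int (numer x) / of_int (denom x) < mediant x y"
    unfolding mediant_eq using * p by (simp add: field_simps add_pos_pos)
  then show "x < mediant x y" by (simp flip: rat_numer_denom)
  have "mediant x y < of_int (numer y) / of_int (denom y)"
    unfolding mediant_eq using * p by (simp add: field_simps add_pos_pos)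
  then show "mediant x y < y" by (simp flip: rat_numer_denom)
qed

lemma farey_upto_1: "farey_upto (Suc 0) = {0, 1}"
  by (simp add: farey_upto_def)

lemma farey_upto_Suc:
  "farey_upto (Suc (Suc n)) =
     farey_upto (Suc n) \<union> {mediant x y | x y. adjacent (farey_upto (Suc n)) x y}"
proof -
  have "{1..Suc (Suc n)} = insert (Suc (Suc n)) {1..Suc n}" by auto
  then have "farey_upto (Suc (Suc n)) = farey_level (Suc (Suc n)) \<union> farey_upto (Suc n)"
    by (simp only: farey_upto_def UN_insert)
  then show ?thesis
    by (simp only: farey_level.simps Un_commute flip: farey_upto_def)
qed

lemma farey_upto_mono: "m \<le> n \<Longrightarrow> farey_upto m \<subseteq> farey_upto n"
  unfolding farey_upto_def by (rule UN_mono) auto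

lemma farey_upto_range: "x \<in> farey_upto (Suc n) \<Longrightarrow> 0 \<le> x \<and> x \<le> 1"
proof (induction n arbitrary: x)
  case 0
  then show ?case by (auto simp: farey_upto_1)
next
  case (Suc n)
  from Suc.prems consider "x \<in> farey_upto (Suc n)"
    | a b where "adjacent (farey_upto (Suc n)) a b" "x = mediant a b"
    unfolding farey_upto_Suc by blast
  then show ?case
  proof cases
    case 1
    then show ?thesis using Suc.IH by blast
  next
    case 2
    then have "0 \<le> a" "b \<le> 1" "a < x" "x < b"
      using Suc.IH[of a] Suc.IH[of b] mediant_between[of a b] unfolding adjacent_def by blast+
    then show ?thesis by linarith
  qed
qed

lemma finite_farey_upto: "finite (farey_upto n)"
proof (induction n)
  case 0
  show ?case by (simp add: farey_upto_def)
next
  case (Suc n)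
  show ?case
  proof (cases n)
    case 0
    then show ?thesis by (simp add: farey_upto_1)
  next
    case (Suc m)
    have "{mediant x y | x y. adjacent (farey_upto n) x y}
        \<subseteq> (\<lambda>(x, y). mediant x y) ` (farey_upto n \<times> farey_upto n)"
      by (auto simp: adjacent_def)
    then have "finite {mediant x y | x y. adjacent (farey_upto n) x y}"
      using Suc.IH by (meson finite_SigmaI finite_imageI finite_subset)
    then show ?thesis
      using Suc.IH unfolding Suc farey_upto_Suc by simp
  qed
qed

lemma ex_adjacent:
  assumes "finite S" "a \<in> S" "b \<in> S" "a < x" "x < b" "x \<notin> S"
  obtains c d where "adjacent S c d" "c < x" "x < d"
proof -
  let ?L = "{z \<in> S. z < x}" and ?R = "{z \<in> S. x < z}"
  have L: "finite ?L" "?L \<noteq> {}" and R: "finite ?R" "?R \<noteq> {}" using assms by auto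
  have 1: "Max ?L \<in> ?L" "Min ?R \<in> ?R" using Max_in[OF L] Min_in[OF R] by auto
  have "\<not> (Max ?L < z \<and> z < Min ?R)" if "z \<in> S" for z
  proof
    assume z: "Max ?L < z \<and> z < Min ?R"
    have "z \<noteq> x" using that assms by auto
    then consider "z < x" | "x < z" by force
    then show False
    proof cases
      case 1
      then have "z \<le> Max ?L" using that L by (intro Max_ge) auto
      then show False using z by simp
    next
      case 2
      then have "Min ?R \<le> z" using that R by (intro Min_le) auto
      then show False using z by simp
    qed
  qed
  then have "adjacent S (Max ?L) (Min ?R)" using 1 by (auto simp: adjacent_def)
  then show ?thesis using 1 that by blast
qed

lemma adjacent_unique:
  assumes "adjacent S a b" "adjacent S c d" "a < x" "x < b" "c < x" "x < d"
  shows "a = c \<and> b = d"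
proof -
  have "\<not> a < c" "\<not> c < a" "\<not> b < d" "\<not> d < b"
    using assms unfolding adjacent_def by (blast dest: less_trans)+
  then show ?thesis by force
qed

lemma farey_parents_unique:
  assumes "farey_parents x a b" "farey_parents x c d"
  shows "a = c \<and> b = d"
proof -
  obtain n m where n: "adjacent (farey_upto (Suc n)) a b" "x = mediant a b"
    and m: "adjacent (farey_upto (Suc m)) c d" "x = mediant c d"
    using assms unfolding farey_parents_def by (metis One_nat_def Suc_le_D)
  have btw: "a < x" "x < b" "c < x" "x < d"
    using n m mediant_between[of a b] mediant_between[of c d] by (simp_all add: adjacent_def)
  have *: False if nm: "n' < m'" and n': "adjacent (farey_upto (Suc n')) a' b'" "x = mediant a' b'"
    and m': "adjacent (farey_upto (Suc m')) c' d'" "c' < x" "x < d'" for n' m' a' b' c' d'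
  proof -
    have "x \<in> farey_upto (Suc (Suc n'))"
      unfolding farey_upto_Suc using n' by blast
    then have "x \<in> farey_upto (Suc m')" using farey_upto_mono[of "Suc (Suc n')" "Suc m'"] nm by auto
    then show False using m' unfolding adjacent_def by blast
  qed
  have "n = m"
    using *[OF _ n m(1) btw(3,4)] *[OF _ m n(1) btw(1,2)] by (cases n m rule: linorder_cases) blast+
  then show ?thesis using adjacent_unique n m btw by blast
qed

lemma farey_parents_range:
  assumes "farey_parents x a b"
  shows "0 \<le> a" "a < x" "x < b" "b \<le> 1"
proof -
  obtain n where n: "adjacent (farey_upto (Suc n)) a b" "x = mediant a b"
    using assms unfolding farey_parents_def by (metis One_nat_def Suc_le_D)
  then show "0 \<le> a" "a < x" "x < b" "b \<le> 1"
    using mediant_between[of a b] farey_upto_range unfolding adjacent_def by blast+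
qed

lemma farey_adjacent_det:
  "adjacent (farey_upto (Suc n)) a b \<Longrightarrow>
     numer b * denom a - numer a * denom b = 1 \<and> denom a + denom b \<ge> int n + 2"
proof (induction n arbitrary: a b)
  case 0
  then have "a = 0" "b = 1" unfolding adjacent_def farey_upto_1 by auto
  then show ?case by (simp add: numer_def denom_def)
next
  case (Suc n)
  let ?U = "farey_upto (Suc n)"
  have split: "numer (mediant c d) = numer c + numer d \<and> denom (mediant c d) = denom c + denom d"
    if "adjacent ?U c d" for c d
  proof -
    have det: "numer d * denom c - numer c * denom d = 1" using Suc.IH[OF that] by simp
    have "coprime (numer c + numer d) (denom c + denom d)"
    proof (rule coprimeI)
      fix e assume e: "e dvd numer c + numer d" "e dvd denom c + denom d"
      have "(numer c + numer d) * denom c - numer c * (denom c + denom d) = 1"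
        using det by (simp add: algebra_simps)
      then show "is_unit e" using e by (metis dvd_diff dvd_mult dvd_mult2)
    qed
    then have "quotient_of (mediant c d) = (numer c + numer d, denom c + denom d)"
      unfolding mediant_def using denom_pos[of c] denom_pos[of d]
      by (simp add: quotient_of_Fract normalize_stable)
    then show ?thesis by (simp add: numer_def denom_def)
  qed
  have ab: "a < b" "a \<in> farey_upto (Suc (Suc n))" "b \<in> farey_upto (Suc (Suc n))"
    "\<And>z. z \<in> farey_upto (Suc (Suc n)) \<Longrightarrow> a < z \<Longrightarrow> z < b \<Longrightarrow> False"
    using Suc.prems unfolding adjacent_def by blast+
  have med: "mediant c d \<in> farey_upto (Suc (Suc n))" if "adjacent ?U c d" for c d
    unfolding farey_upto_Suc using that by blast
  have sub: "?U \<subseteq> farey_upto (Suc (Suc n))" unfolding farey_upto_Suc by blast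
  have key: "(a \<in> ?U \<and> b = mediant c d \<and> a = c) \<or> (b \<in> ?U \<and> a = mediant c d \<and> b = d)"
    if cd: "adjacent ?U c d" "a = mediant c d \<or> b = mediant c d" for c d
  proof -
    have c: "c \<in> ?U" "d \<in> ?U" "c < mediant c d" "mediant c d < d"
      using cd mediant_between unfolding adjacent_def by blast+
    have gap: "z = c \<or> z < c \<or> z = mediant c d \<or> z = d \<or> d < z"
      if z: "z \<in> farey_upto (Suc (Suc n))" for z
    proof -
      consider "z \<in> ?U" | p q where "adjacent ?U p q" "z = mediant p q"
        using z unfolding farey_upto_Suc by blast
      then show ?thesis
      proof cases
        case 1
        then show ?thesis using cd(1) unfolding adjacent_def by force
      next
        case 2
        then have "p < z" "z < q" using mediant_between unfolding adjacent_def by blast+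
        then show ?thesis
          using adjacent_unique[OF 2(1) cd(1), of z] 2(2) by (metis linorder_neqE)
      qed
    qed
    from cd(2) show ?thesis
    proof
      assume a: "a = mediant c d"
      have "d \<le> b" using gap[OF ab(3)] ab(1) a c by auto
      then have "b = d" using ab(4)[of d] c sub a by force
      then show ?thesis using a c by blast
    next
      assume b: "b = mediant c d"
      have "a \<le> c" using gap[OF ab(2)] ab(1) b c by auto
      then have "a = c" using ab(4)[of c] c sub b by force
      then show ?thesis using b c by blast
    qed
  qed
  obtain c d where cd: "adjacent ?U c d" "a = mediant c d \<or> b = mediant c d"
  proof (cases "a \<in> ?U \<and> b \<in> ?U")
    case True
    then have "adjacent ?U a b" using ab sub unfolding adjacent_def by blast
    then show ?thesis using med ab(4) mediant_between[OF ab(1)] by blast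
  next
    case False
    then show ?thesis using ab(2,3) that unfolding farey_upto_Suc by blast
  qed
  have IH: "numer d * denom c - numer c * denom d = 1" "denom c + denom d \<ge> int n + 2"
    using Suc.IH[OF cd(1)] by auto
  from key[OF cd] show ?case
    using split[OF cd(1)] IH denom_pos[of c] denom_pos[of d] by (auto simp: algebra_simps)
qed

lemma farey_complete:
  assumes "0 \<le> x" "x \<le> 1"
  shows "\<exists>n. x \<in> farey_upto (Suc n)"
proof (rule ccontr)
  assume none: "\<nexists>n. x \<in> farey_upto (Suc n)"
  define n where "n = nat (denom x)"
  have "0 \<in> farey_upto (Suc 0)" "1 \<in> farey_upto (Suc 0)" by (simp_all add: farey_upto_1)
  then have U: "0 \<in> farey_upto (Suc n)" "1 \<in> farey_upto (Suc n)"
    using farey_upto_mono[of "Suc 0" "Suc n"] by auto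
  have "x \<notin> farey_upto (Suc n)" using none by blast
  then obtain a b where ab: "adjacent (farey_upto (Suc n)) a b" "a < x" "x < b"
    using ex_adjacent[OF finite_farey_upto U, of x] U assms by (metis order_le_less)
  have det: "numer b * denom a - numer a * denom b = 1" "denom a + denom b \<ge> int n + 2"
    using farey_adjacent_det[OF ab(1)] by auto
  let ?s = "numer x * denom a - numer a * denom x" and ?t = "numer b * denom x - numer x * denom b"
  have "?s \<ge> 1" "?t \<ge> 1" using ab(2,3) unfolding less_iff_cross by simp_all
  then have "denom b * ?s + denom a * ?t \<ge> denom b * 1 + denom a * 1"
    using denom_pos[of a] denom_pos[of b] by (intro add_mono mult_left_mono) auto
  moreover have "denom b * ?s + denom a * ?t = denom x * (numer b * denom a - numer a * denom b)"
    by (simp add: algebra_simps)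
  ultimately have "denom x \<ge> denom a + denom b" using det by simp
  then show False using det denom_pos[of x] by (simp add: n_def)
qed

lemma is_haros_graph_unique: "is_haros_graph x G \<Longrightarrow> is_haros_graph x H \<Longrightarrow> G = H"
proof (induction arbitrary: H rule: is_haros_graph.induct)
  case zero
  from zero show ?case
    by (cases rule: is_haros_graph.cases) (use farey_parents_range in fastforce)+
next
  case one
  from one show ?case
    by (cases rule: is_haros_graph.cases) (use farey_parents_range in fastforce)+
next
  case (mediant x a b G G')
  have "x \<noteq> 0" "x \<noteq> 1" using farey_parents_range[OF mediant.hyps(1)] by auto
  with mediant.prems obtain c d K K' where
    "H = K \<oplus> K'" "farey_parents x c d" "is_haros_graph c K" "is_haros_graph d K'"
    by (cases rule: is_haros_graph.cases) auto
  then show ?case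
    using farey_parents_unique[OF mediant.hyps(1)] mediant.IH by blast
qed

lemma is_haros_graph_exists: "x \<in> farey_upto (Suc n) \<Longrightarrow> \<exists>G. is_haros_graph x G"
proof (induction n arbitrary: x)
  case 0
  then show ?case by (auto simp: farey_upto_1 intro: is_haros_graph.intros)
next
  case (Suc n)
  from Suc.prems consider "x \<in> farey_upto (Suc n)"
    | a b where "adjacent (farey_upto (Suc n)) a b" "x = mediant a b"
    unfolding farey_upto_Suc by blast
  then show ?case
  proof cases
    case 1
    then show ?thesis using Suc.IH by blast
  next
    case 2
    then obtain G H where "is_haros_graph a G" "is_haros_graph b H"
      using Suc.IH unfolding adjacent_def by blast
    moreover have "farey_parents x a b"
      unfolding farey_parents_def using 2 by (intro conjI exI[of _ "Suc n"]) auto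
    ultimately show ?thesis using is_haros_graph.mediant by blast
  qed
qed

theorem haros_graph_well_defined:
  assumes "0 \<le> x" "x \<le> 1"
  shows "\<exists>!G. is_haros_graph x G"
proof -
  obtain n where "x \<in> farey_upto (Suc n)" using farey_complete[OF assms] by blast
  then obtain G where "is_haros_graph x G" using is_haros_graph_exists by blast
  then show ?thesis by (intro ex1I) (auto intro: is_haros_graph_unique)
qed

end

theory Submission
  imports Defs
begin

text \<open>
  The map \<open>F\<close> sends the Farey tree onto its left subtree and keeps parents, so the graph of \<open>F x\<close>
  arises from the same sums as the graph of \<open>x\<close>, with the base graph of \<open>1/1\<close> replaced by the
  triangle \<open>G\<^bsub>1/2\<^esub>\<close>. Hence the degree of the first node grows by one exactly if \<open>x = 1\<close>, and that
  of the last node exactly if \<open>x \<noteq> 0\<close>. A node obtained by gluing \<open>G\<^sub>a\<close> to \<open>G\<^sub>b\<close> therefore gains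
  exactly one, unless \<open>a = 0\<close> or \<open>b = 1\<close>; but then \<open>b = 1/n\<close> or \<open>a = (n-1)/n\<close>, the degree of the
  node is at most \<open>3\<close>, and it is at most \<open>5\<close> in the graph of \<open>F x\<close>. So the nodes of degree \<open>k \<ge> 5\<close>
  correspond to those of degree \<open>k + 1\<close>, while the number of nodes changes from \<open>q\<close> to \<open>p + q\<close>.
\<close>

section \<open>Farey parents\<close>

lemma numer_denom_Fract:
  assumes "coprime p q" "q > 0"
  shows "numer (Fract p q) = p" "denom (Fract p q) = q"
  using assms by (simp_all add: numer_def denom_def quotient_of_Fract normalize_stable)

lemma coprime_numer_denom: "coprime (numer x) (denom x)"
  unfolding numer_def denom_def by (rule quotient_of_coprime) simp

lemma numer_denom_0: "numer 0 = 0" "denom 0 = 1"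
  and numer_denom_1: "numer 1 = 1" "denom 1 = 1"
  by (simp_all add: numer_def denom_def)

lemma rat_eqI: "numer x = numer y \<Longrightarrow> denom x = denom y \<Longrightarrow> x = y"
  by (metis rat_numer_denom)

lemma numer_nonneg: "0 \<le> x \<Longrightarrow> 0 \<le> numer x"
  using less_iff_cross[of x 0] by (simp add: numer_denom_0)

lemma numer_le_denom: "x \<le> 1 \<Longrightarrow> numer x \<le> denom x"
  using less_iff_cross[of 1 x] by (simp add: numer_denom_1)

text \<open>With determinant one the mediant is already reduced: a common divisor of its two entries
  divides the determinant.\<close>

lemma numer_denom_mediant:
  assumes det: "numer b * denom a - numer a * denom b = 1"
  shows "numer (mediant a b) = numer a + numer b" "denom (mediant a b) = denom a + denom b"
proof -
  have "coprime (numer a + numer b) (denom a + denom b)"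
  proof (rule coprimeI)
    fix e assume e: "e dvd numer a + numer b" "e dvd denom a + denom b"
    have "(numer a + numer b) * denom a - numer a * (denom a + denom b) = 1"
      using det by (simp add: algebra_simps)
    then show "is_unit e" using e by (metis dvd_diff dvd_mult dvd_mult2)
  qed
  moreover have "denom a + denom b > 0" using denom_pos[of a] denom_pos[of b] by simp
  ultimately show "numer (mediant a b) = numer a + numer b" "denom (mediant a b) = denom a + denom b"
    unfolding mediant_def by (simp_all add: numer_denom_Fract)
qed

lemma farey_parents_det:
  assumes "farey_parents x a b"
  shows "numer b * denom a - numer a * denom b = 1"
    "numer x = numer a + numer b" "denom x = denom a + denom b"
proof -
  obtain n where n: "adjacent (farey_upto (Suc n)) a b" "x = mediant a b"
    using assms unfolding farey_parents_def by (metis One_nat_def Suc_le_D)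
  show det: "numer b * denom a - numer a * denom b = 1"
    using farey_adjacent_det[OF n(1)] by simp
  show "numer x = numer a + numer b" "denom x = denom a + denom b"
    using numer_denom_mediant[OF det] n(2) by simp_all
qed

text \<open>A fraction strictly inside the interval has a Haros graph, and only the mediant rule can
  have produced it; that rule supplies the parents.\<close>

lemma farey_parents_exists:
  assumes "0 < x" "x < 1"
  obtains a b where "farey_parents x a b"
proof -
  obtain G where "is_haros_graph x G"
    using haros_graph_well_defined[of x] assms by auto
  then show ?thesis
    by (cases rule: is_haros_graph.cases) (use assms that in auto)
qed

text \<open>Removes the levels from the notion of parents: a determinant is easy to carry along
  \<open>F_map\<close>, adjacency within a level is not. For the converse, the true parents
  \<open>c\<close>, \<open>d\<close> of \<open>x\<close> satisfy the same equation as
  \<open>a\<close>, \<open>b\<close>, and its solution is unique in the relevant range.\<close>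

lemma farey_parents_iff_det:
  "farey_parents x a b \<longleftrightarrow>
     0 \<le> a \<and> b \<le> 1 \<and> numer b * denom a - numer a * denom b = 1 \<and> x = mediant a b"
proof
  assume "farey_parents x a b"
  then show "0 \<le> a \<and> b \<le> 1 \<and> numer b * denom a - numer a * denom b = 1 \<and> x = mediant a b"
    using farey_parents_range[of x a b] farey_parents_det(1)[of x a b]
    by (simp add: farey_parents_def)
next
  assume R: "0 \<le> a \<and> b \<le> 1 \<and> numer b * denom a - numer a * denom b = 1 \<and> x = mediant a b"
  then have det: "numer b * denom a - numer a * denom b = 1" and x: "x = mediant a b" by auto
  have "a < b" using det by (simp add: less_iff_cross)
  then have "0 < x" "x < 1" using mediant_between[of a b] R by auto
  then obtain c d where cd: "farey_parents x c d" by (rule farey_parents_exists)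
  note cd' = farey_parents_det[OF cd]
  have nx: "numer x = numer a + numer b" "denom x = denom a + denom b"
    using numer_denom_mediant[OF det] x by simp_all
  have "numer x * denom a - numer a * denom x = 1"
    using det nx by (simp add: algebra_simps)
  moreover have "numer x * denom c - numer c * denom x = 1"
    using cd' by (simp add: algebra_simps)
  \<comment> \<open>\<open>a\<close> and \<open>c\<close> solve the same linear Diophantine
    equation, so their denominators are congruent modulo \<open>denom x\<close>; both lie strictly
    between 0 and \<open>denom x\<close>, hence they agree.\<close>
  ultimately have *: "numer x * (denom a - denom c) = denom x * (numer a - numer c)"
    by (simp add: algebra_simps)
  then have "denom x dvd numer x * (denom a - denom c)" by simp
  then have "denom x dvd denom a - denom c"
    using coprime_numer_denom[of x] by (simp add: coprime_dvd_mult_right_iff coprime_commute)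
  moreover have "\<bar>denom a - denom c\<bar> < denom x"
    using nx cd' denom_pos[of a] denom_pos[of b] denom_pos[of c] denom_pos[of d] by linarith
  ultimately have da: "denom a = denom c"
    using dvd_imp_le_int[of "denom a - denom c" "denom x"] by fastforce
  with * have na: "numer a = numer c" using denom_pos[of x] by simp
  have "a = c" "b = d" using da na nx cd' by (auto intro!: rat_eqI)
  with cd show "farey_parents x a b" by simp
qed

section \<open>The action of \<open>F_map\<close> on reduced fractions and on parents\<close>

lemma numer_denom_F_map:
  assumes "0 \<le> x"
  shows "numer (F_map x) = numer x" "denom (F_map x) = numer x + denom x"
proof -
  have pos: "numer x + denom x > 0" using numer_nonneg[OF assms] denom_pos[of x] by simp
  have "F_map x = of_int (numer x) / of_int (numer x + denom x)"
  proof -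
    have "(of_int (denom x) :: rat) > 0" "(of_int (numer x) :: rat) \<ge> 0"
      using denom_pos numer_nonneg[OF assms] by simp_all
    then have "(of_int (numer x) / of_int (denom x)) / (1 + of_int (numer x) / of_int (denom x))
        = (of_int (numer x) / of_int (numer x + denom x) :: rat)"
      by (simp add: divide_simps)
    then show ?thesis unfolding F_map_def by (simp flip: rat_numer_denom)
  qed
  then have "F_map x = Fract (numer x) (numer x + denom x)"
    by (simp only: Fract_of_int_quotient)
  moreover have "coprime (numer x) (numer x + denom x)"
    using coprime_numer_denom[of x] by (simp add: coprime_iff_gcd_eq_1)
  ultimately show "numer (F_map x) = numer x" "denom (F_map x) = numer x + denom x"
    using numer_denom_Fract pos by simp_all
qed

lemma F_map_range:
  assumes "0 \<le> x"
  shows "0 \<le> F_map x" "F_map x \<le> 1"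
  using assms by (simp_all add: F_map_def field_simps)

text \<open>On pairs (numerator, denominator) \<open>F_map\<close> is the linear map sending (p, q)
  to (p, p + q), of determinant one. It therefore respects both mediants and the determinant of a
  pair.\<close>

lemma farey_parents_F_map:
  assumes "farey_parents x a b"
  shows "farey_parents (F_map x) (F_map a) (F_map b)"
proof -
  note r = farey_parents_range[OF assms] and d = farey_parents_det[OF assms]
  have nn: "0 \<le> a" "0 \<le> b" "0 \<le> x" using r by auto
  have det: "numer (F_map b) * denom (F_map a) - numer (F_map a) * denom (F_map b) = 1"
    using d(1) by (simp add: numer_denom_F_map nn algebra_simps)
  have "F_map x = mediant (F_map a) (F_map b)"
    using d numer_denom_mediant[OF det] by (intro rat_eqI) (simp_all add: numer_denom_F_map nn)
  then show ?thesis
    unfolding farey_parents_iff_det using det F_map_range nn by auto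
qed

section \<open>Degrees in a concatenation\<close>

text \<open>The invariant that makes degrees additive under gluing: the summands share a single
  node, so an edge with two distinct ends cannot belong to both.\<close>

definition simple_graph :: "ordered_graph \<Rightarrow> bool" where
  "simple_graph G \<longleftrightarrow>
     2 \<le> node_count G \<and> finite (edges G) \<and> (\<forall>e\<in>edges G. e \<subseteq> {1..node_count G} \<and> card e = 2)"

lemma node_degree_outside:
  assumes "simple_graph G" "v \<notin> {1..node_count G}"
  shows "node_degree G v = 0"
proof -
  have "{e \<in> edges G. v \<in> e} = {}" using assms unfolding simple_graph_def by blast
  then show ?thesis unfolding node_degree_def by (simp only: card.empty)
qed

lemma simple_graph_base: "simple_graph haros_base"
  by (simp add: simple_graph_def haros_base_def)

lemma simple_graph_concat:
  assumes "simple_graph G" "simple_graph H"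
  shows "simple_graph (G \<oplus> H)"
proof -
  let ?m = "node_count G" and ?n = "node_count H"
  let ?s = "\<lambda>j. j + (?m - 1)"
  have c: "2 \<le> ?m" "2 \<le> ?n" using assms by (auto simp: simple_graph_def)
  have "e \<subseteq> {1..?m + ?n - 1} \<and> card e = 2" if "e \<in> edges (G \<oplus> H)" for e
  proof -
    from that consider "e \<in> edges G" | h where "h \<in> edges H" "e = ?s ` h" | "e = {1, ?m + ?n - 1}"
      by (auto simp: graph_concat_def)
    then show ?thesis
    proof cases
      case 1
      then have "e \<subseteq> {1..?m}" "card e = 2" using assms(1) by (auto simp: simple_graph_def)
      then show ?thesis using c by fastforce
    next
      case 2
      then have h: "h \<subseteq> {1..?n}" "card h = 2" using assms(2) by (auto simp: simple_graph_def)
      have "card e = 2" using h(2) 2(2) by (simp add: card_image)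
      moreover have "e \<subseteq> {1..?m + ?n - 1}" using h(1) 2(2) c by fastforce
      ultimately show ?thesis by simp
    next
      case 3
      then show ?thesis using c by auto
    qed
  qed
  then show ?thesis
    using assms c by (simp add: simple_graph_def graph_concat_def)
qed

text \<open>The edges at \<open>v\<close> split into those of \<open>G\<close>, the shifted ones of
  \<open>H\<close> and the closing edge. The first summand carries no bound on \<open>v\<close>,
  because \<open>node_degree\<close> is 0 beyond the nodes of \<open>G\<close>; at the glued node
  both summands contribute.\<close>

lemma node_degree_concat:
  assumes G: "simple_graph G" and H: "simple_graph H"
  shows "node_degree (G \<oplus> H) v =
    node_degree G v + (if node_count G \<le> v then node_degree H (v - (node_count G - 1)) else 0)
    + (if v = 1 \<or> v = node_count (G \<oplus> H) then 1 else 0)"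
proof -
  let ?m = "node_count G" and ?n = "node_count H"
  let ?s = "\<lambda>j. j + (?m - 1)"
  let ?A = "{e \<in> edges G. v \<in> e}" and ?B = "{e \<in> (`) ?s ` edges H. v \<in> e}"
  let ?C = "{e \<in> {{1, ?m + ?n - 1}}. v \<in> e}"
  have c: "2 \<le> ?m" "2 \<le> ?n" using assms by (auto simp: simple_graph_def)
  have fin: "finite ?A" "finite ?B" "finite ?C" using assms by (auto simp: simple_graph_def)
  have E: "e \<subseteq> {1..?m}" "card e = 2" if "e \<in> edges G" for e
    using G that by (auto simp: simple_graph_def)
  have E': "e \<subseteq> {?m..?m + ?n - 1}" if "e \<in> (`) ?s ` edges H" for e
    using H that c by (fastforce simp: simple_graph_def)
  have AB: "?A \<inter> ?B = {}"
  proof (rule ccontr)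
    assume "?A \<inter> ?B \<noteq> {}"
    then obtain e where e: "e \<in> edges G" "e \<in> (`) ?s ` edges H" by blast
    then have "e \<subseteq> {?m}" using E(1)[OF e(1)] E'[OF e(2)] by fastforce
    then have "card e \<le> 1" using card_mono[of "{?m}" e] by simp
    then show False using E(2)[OF e(1)] by simp
  qed
  \<comment> \<open>The closing edge is new: its right end lies beyond \<open>G\<close> and its left
    end lies before the shifted \<open>H\<close>, as both graphs have at least two nodes.\<close>
  have ABC: "(?A \<union> ?B) \<inter> ?C = {}"
    using E(1)[of "{1, ?m + ?n - 1}"] E'[of "{1, ?m + ?n - 1}"] c by auto
  have "{e \<in> edges (G \<oplus> H). v \<in> e} = ?A \<union> ?B \<union> ?C"
    by (auto simp: graph_concat_def)
  then have "node_degree (G \<oplus> H) v = card ?A + card ?B + card ?C"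
    unfolding node_degree_def using fin AB ABC by (simp add: card_Un_disjoint)
  moreover have "card ?C = (if v = 1 \<or> v = node_count (G \<oplus> H) then 1 else 0)"
  proof -
    have "?C = (if v = 1 \<or> v = ?m + ?n - 1 then {{1, ?m + ?n - 1}} else {})" by auto
    then show ?thesis by (simp add: graph_concat_def)
  qed
  moreover have "card ?B = (if ?m \<le> v then node_degree H (v - (?m - 1)) else 0)"
  proof (cases "?m \<le> v")
    case True
    have "?B = (`) ?s ` {e \<in> edges H. v - (?m - 1) \<in> e}"
    proof -
      have "v \<in> ?s ` h \<longleftrightarrow> v - (?m - 1) \<in> h" for h
        using True c by (auto simp: image_iff intro!: bexI[of _ "v - (?m - 1)"])
      then show ?thesis by auto
    qed
    \<comment> \<open>Distinct edges of \<open>H\<close> stay distinct after the shift, so the count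
      is preserved.\<close>
    moreover have "inj ((`) ?s)" by (intro injI) (simp add: inj_image_eq_iff)
    ultimately show ?thesis
      using True by (simp add: node_degree_def card_image inj_on_subset)
  next
    case False
    have "v \<notin> e" if "e \<in> (`) ?s ` edges H" for e
      using E'[OF that] False by auto
    then have "?B = {}" by blast
    then show ?thesis using False by (simp only: card.empty if_False)
  qed
  ultimately show ?thesis by (simp add: node_degree_def)
qed

lemma node_count_concat:
  "simple_graph G \<Longrightarrow> simple_graph H \<Longrightarrow>
     node_count (G \<oplus> H) - 1 = (node_count G - 1) + (node_count H - 1)"
  by (simp add: graph_concat_def simple_graph_def)

section \<open>Boundary degrees and interior degree counts under gluing\<close>

definition first_degree :: "ordered_graph \<Rightarrow> nat" where
  "first_degree G = node_degree G 1"

definition last_degree :: "ordered_graph \<Rightarrow> nat" where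
  "last_degree G = node_degree G (node_count G)"

text \<open>Both end nodes are left out: their degrees still change in later concatenations, whereas
  interior degrees are final.\<close>

definition interior_count :: "ordered_graph \<Rightarrow> nat \<Rightarrow> nat" where
  "interior_count G k = card {v \<in> {1<..<node_count G}. node_degree G v = k}"

lemma base_degrees:
  "first_degree haros_base = 1" "last_degree haros_base = 1" "interior_count haros_base k = 0"
proof -
  have "{e :: nat set. e = {1, 2} \<and> v \<in> e} = (if v \<in> {1, 2} then {{1, 2}} else {})" for v
    by auto
  then show "first_degree haros_base = 1" "last_degree haros_base = 1"
    by (simp_all add: first_degree_def last_degree_def node_degree_def haros_base_def)
  have "{1<..<2} = ({} :: nat set)" by auto
  then show "interior_count haros_base k = 0"
    by (simp add: interior_count_def haros_base_def)
qed

lemma first_degree_concat: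
  assumes "simple_graph G" "simple_graph H"
  shows "first_degree (G \<oplus> H) = first_degree G + 1"
proof -
  have "2 \<le> node_count G" using assms by (simp add: simple_graph_def)
  then show ?thesis by (simp add: first_degree_def node_degree_concat[OF assms])
qed

lemma last_degree_concat:
  assumes "simple_graph G" "simple_graph H"
  shows "last_degree (G \<oplus> H) = last_degree H + 1"
proof -
  have c: "2 \<le> node_count G" "2 \<le> node_count H" using assms by (auto simp: simple_graph_def)
  then have "node_count (G \<oplus> H) \<notin> {1..node_count G}"
    "node_count G \<le> node_count (G \<oplus> H)"
    "node_count (G \<oplus> H) - (node_count G - 1) = node_count H"
    by (auto simp: graph_concat_def)
  then show ?thesis
    using node_degree_outside[OF assms(1)]
    by (simp add: last_degree_def node_degree_concat[OF assms] del: atLeastAtMost_iff)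
qed

text \<open>The closing edge touches only the two ends, so old interior nodes keep their degrees,
  and the glued node is the only new interior one.\<close>

lemma interior_count_concat:
  assumes "simple_graph G" "simple_graph H"
  shows "interior_count (G \<oplus> H) k = interior_count G k + interior_count H k
    + (if last_degree G + first_degree H = k then 1 else 0)"
proof -
  let ?m = "node_count G" and ?n = "node_count H" and ?K = "G \<oplus> H"
  let ?s = "\<lambda>j. j + (?m - 1)"
  have c: "2 \<le> ?m" "2 \<le> ?n" using assms by (auto simp: simple_graph_def)
  have N: "node_count ?K = ?m + ?n - 1" by (simp add: graph_concat_def)
  let ?I = "{v \<in> {1<..<node_count ?K}. node_degree ?K v = k}"
  let ?A = "{v \<in> {1<..<?m}. node_degree G v = k}"
  let ?B = "{v \<in> {1<..<?n}. node_degree H v = k}"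
  \<comment> \<open>Either \<open>{?m}\<close> or empty, so that its cardinality is the conditional
    term of the claim.\<close>
  let ?C = "{v \<in> {?m}. last_degree G + first_degree H = k}"
  have dA: "node_degree ?K v = node_degree G v" if "v \<in> {1<..<?m}" for v
    using that c by (auto simp: node_degree_concat[OF assms] N)
  have dB: "node_degree ?K (?s v) = node_degree H v" if "v \<in> {1<..<?n}" for v
    using that c node_degree_outside[OF assms(1), of "?s v"]
    by (auto simp: node_degree_concat[OF assms] N)
  have dC: "node_degree ?K ?m = last_degree G + first_degree H"
    using c by (simp add: node_degree_concat[OF assms] N last_degree_def first_degree_def)
  have "?I = ?A \<union> ?s ` ?B \<union> ?C"
  proof (intro equalityI subsetI)
    fix v assume v: "v \<in> ?I"
    consider "v < ?m" | "v = ?m" | "v > ?m" by force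
    then show "v \<in> ?A \<union> ?s ` ?B \<union> ?C"
    proof cases
      case 1
      then show ?thesis using v dA[of v] by auto
    next
      case 2
      then show ?thesis using v dC by auto
    next
      case 3
      define w where "w = v - (?m - 1)"
      have w: "v = ?s w" "w \<in> {1<..<?n}" using 3 v c by (auto simp: w_def N)
      then have "w \<in> ?B" using dB[of w] v by auto
      then show ?thesis using w(1) by blast
    qed
  next
    fix v assume "v \<in> ?A \<union> ?s ` ?B \<union> ?C"
    then consider "v \<in> ?A" | w where "w \<in> ?B" "v = ?s w" | "v \<in> ?C" by blast
    then show "v \<in> ?I"
    proof cases
      case 1
      then show ?thesis using dA[of v] c by (auto simp: N)
    next
      case 2
      then show ?thesis using dB[of w] c by (auto simp: N)
    next
      case 3
      then show ?thesis using dC c by (auto simp: N)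
    qed
  qed
  moreover have "?A \<inter> ?s ` ?B = {}" "(?A \<union> ?s ` ?B) \<inter> ?C = {}" by auto
  moreover have "card (?s ` ?B) = card ?B" by (intro card_image) simp
  ultimately have "card ?I = card ?A + card ?B + card ?C" by (simp add: card_Un_disjoint)
  moreover have "card ?C = (if last_degree G + first_degree H = k then 1 else 0)" by simp
  ultimately show ?thesis by (simp add: interior_count_def)
qed

lemma closed_degree_count:
  assumes "simple_graph G"
  shows "card {v \<in> closed_nodes G. closed_degree G v = k} =
    interior_count G k + (if first_degree G + last_degree G = k then 1 else 0)"
proof -
  let ?A = "{v \<in> {1<..<node_count G}. node_degree G v = k}"
  let ?C = "{v \<in> {1}. first_degree G + last_degree G = k}"
  have "{v \<in> closed_nodes G. closed_degree G v = k} = ?A \<union> ?C"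
    using assms by (auto simp: closed_nodes_def closed_degree_def simple_graph_def
        first_degree_def last_degree_def)
  moreover have "?A \<inter> ?C = {}" by auto
  moreover have "card ?C = (if first_degree G + last_degree G = k then 1 else 0)" by simp
  ultimately show ?thesis by (simp add: interior_count_def card_Un_disjoint)
qed

section \<open>Haros graphs under \<open>F\<close>\<close>

lemma is_haros_graph_simple:
  "is_haros_graph x G \<Longrightarrow> simple_graph G"
  by (induction rule: is_haros_graph.induct) (simp_all add: simple_graph_base simple_graph_concat)

lemma is_haros_graph_node_count:
  "is_haros_graph x G \<Longrightarrow> int (node_count G - 1) = denom x"
proof (induction rule: is_haros_graph.induct)
  case (mediant x a b G H)
  then show ?case
    using node_count_concat[of G H] is_haros_graph_simple farey_parents_det(3) by simp
qed (simp_all add: haros_base_def numer_denom_0 numer_denom_1)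

lemma is_haros_graph_0: "is_haros_graph 0 G \<Longrightarrow> G = haros_base"
  using is_haros_graph_unique is_haros_graph.zero by blast

lemma is_haros_graph_1: "is_haros_graph 1 G \<Longrightarrow> G = haros_base"
  using is_haros_graph_unique is_haros_graph.one by blast

text \<open>The left parent of 1/n with n > 1 is 0, whose graph is a single edge; the closing edge
  adds one more at the first node.\<close>

lemma first_degree_unit_fraction:
  assumes "is_haros_graph x G" "numer x = 1"
  shows "first_degree G \<le> 2"
  using assms
proof (cases rule: is_haros_graph.cases)
  case (mediant a b K L)
  note r = farey_parents_range[OF mediant(2)] and d = farey_parents_det[OF mediant(2)]
  have "0 < numer b" using r less_iff_cross[of 0 b] by (simp add: numer_denom_0)
  then have "numer a = 0" using d(2) assms(2) numer_nonneg[OF r(1)] by simp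
  then have "a = 0" using rat_numer_denom[of a] by simp
  then have "K = haros_base" using mediant is_haros_graph_0 by blast
  then show ?thesis
    using mediant is_haros_graph_simple[OF mediant(3)] is_haros_graph_simple[OF mediant(4)]
    by (simp add: first_degree_concat base_degrees)
qed (simp_all add: base_degrees)

text \<open>Mirror image of the previous bound: the right parent of (n-1)/n with n > 1 is 1.\<close>

lemma last_degree_unit_complement:
  assumes "is_haros_graph x G" "denom x - numer x = 1"
  shows "last_degree G \<le> 2"
  using assms
proof (cases rule: is_haros_graph.cases)
  case (mediant a b K L)
  note r = farey_parents_range[OF mediant(2)] and d = farey_parents_det[OF mediant(2)]
  have "numer a < denom a" using r less_iff_cross[of a 1] by (simp add: numer_denom_1)
  then have "numer b = denom b" using d(2,3) assms(2) numer_le_denom[OF r(4)] by simp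
  then have "b = 1" using rat_numer_denom[of b] denom_pos[of b] by simp
  then have "L = haros_base" using mediant is_haros_graph_1 by blast
  then show ?thesis
    using mediant is_haros_graph_simple[OF mediant(3)] is_haros_graph_simple[OF mediant(4)]
    by (simp add: last_degree_concat base_degrees)
qed (simp_all add: base_degrees)

text \<open>Covers the gluings at which the join need not gain exactly one. One side is a single
  edge and contributes 1, the determinant forces the other parent to be 1/n or (n-1)/n, and that
  side contributes at most 2.\<close>

lemma join_degree_le_3:
  assumes p: "farey_parents x a b" and G: "is_haros_graph a G" and H: "is_haros_graph b H"
    and "a = 0 \<or> b = 1"
  shows "last_degree G + first_degree H \<le> 3"
  using assms(4)
proof
  assume a: "a = 0"
  then have "numer b = 1" using farey_parents_det(1)[OF p] by (simp add: numer_denom_0)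
  then show ?thesis
    using first_degree_unit_fraction[OF H] is_haros_graph_0[of G] G a by (simp add: base_degrees)
next
  assume b: "b = 1"
  then have "denom a - numer a = 1" using farey_parents_det(1)[OF p] by (simp add: numer_denom_1)
  then show ?thesis
    using last_degree_unit_complement[OF G] is_haros_graph_1[of H] H b by (simp add: base_degrees)
qed

lemma is_haros_graph_half: "is_haros_graph (F_map 1) (haros_base \<oplus> haros_base)"
proof -
  have "farey_parents (F_map 1) 0 1"
    unfolding farey_parents_iff_det
    by (simp add: numer_denom_0 numer_denom_1 F_map_def mediant_eq)
  then show ?thesis using is_haros_graph.zero is_haros_graph.one by (rule is_haros_graph.mediant)
qed

text \<open>The end degrees belong to the induction because the glued node has the last degree of
  one summand plus the first degree of the other. An inner \<open>x\<close> never has 1 as left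
  parent or 0 as right parent, which fixes the gains at the ends.\<close>

lemma is_haros_graph_F_map:
  assumes "is_haros_graph x G"
  shows "\<exists>G'. is_haros_graph (F_map x) G' \<and>
    first_degree G' = first_degree G + (if x = 1 then 1 else 0) \<and>
    last_degree G' = last_degree G + (if x = 0 then 0 else 1) \<and>
    (\<forall>k\<ge>5. interior_count G' (k + 1) = interior_count G k)"
  using assms
proof (induction rule: is_haros_graph.induct)
  case zero
  have "is_haros_graph (F_map 0) haros_base" by (simp add: F_map_def is_haros_graph.zero)
  then show ?case by (intro exI[of _ haros_base]) (simp add: base_degrees)
next
  case one
  show ?case
    using is_haros_graph_half
    by (intro exI[of _ "haros_base \<oplus> haros_base"])
      (simp add: base_degrees first_degree_concat last_degree_concat interior_count_concat
        simple_graph_base)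
next
  case (mediant x a b G H)
  note r = farey_parents_range[OF mediant.hyps(1)]
  obtain G' where G': "is_haros_graph (F_map a) G'"
    "last_degree G' = last_degree G + (if a = 0 then 0 else 1)"
    "first_degree G' = first_degree G + (if a = 1 then 1 else 0)"
    "\<And>k. k \<ge> 5 \<Longrightarrow> interior_count G' (k + 1) = interior_count G k"
    using mediant.IH(1) by blast
  obtain H' where H': "is_haros_graph (F_map b) H'"
    "last_degree H' = last_degree H + (if b = 0 then 0 else 1)"
    "first_degree H' = first_degree H + (if b = 1 then 1 else 0)"
    "\<And>k. k \<ge> 5 \<Longrightarrow> interior_count H' (k + 1) = interior_count H k"
    using mediant.IH(2) by blast
  note simple = is_haros_graph_simple[OF mediant.hyps(2)] is_haros_graph_simple[OF mediant.hyps(3)]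
    is_haros_graph_simple[OF G'(1)] is_haros_graph_simple[OF H'(1)]
  have ne: "a \<noteq> 1" "b \<noteq> 0" "x \<noteq> 0" "x \<noteq> 1" using r by auto
  have "is_haros_graph (F_map x) (G' \<oplus> H')"
    using farey_parents_F_map[OF mediant.hyps(1)] G'(1) H'(1) by (rule is_haros_graph.mediant)
  moreover have "first_degree (G' \<oplus> H') = first_degree (G \<oplus> H)"
    "last_degree (G' \<oplus> H') = last_degree (G \<oplus> H) + 1"
    using simple G' H' ne by (simp_all add: first_degree_concat last_degree_concat)
  moreover have "interior_count (G' \<oplus> H') (k + 1) = interior_count (G \<oplus> H) k" if "5 \<le> k" for k
  proof -
    have "last_degree G' + first_degree H' = k + 1 \<longleftrightarrow> last_degree G + first_degree H = k"
    proof (cases "a = 0 \<or> b = 1")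
      case True
      then have "last_degree G + first_degree H \<le> 3"
        by (rule join_degree_le_3[OF mediant.hyps])
      \<comment> \<open>The join gains at most 2, so its degree is at most 3 before and 5 after:
        both sides are false. The bound \<open>5 \<le> k\<close> is what makes \<open>k + 1\<close>
        exceed 5.\<close>
      then show ?thesis using that G'(2) H'(3) by auto
    next
      case False
      \<comment> \<open>The left summand gains one at its last node, the right one nothing at its
        first.\<close>
      then show ?thesis using G'(2) H'(3) by simp
    qed
    then show ?thesis using that simple G'(4) H'(4) by (simp add: interior_count_concat)
  qed
  ultimately show ?case using ne by (intro exI[of _ "G' \<oplus> H'"]) simp
qed

section \<open>From node counts to the degree distribution\<close>

lemma haros_graph_eq: "is_haros_graph x G \<Longrightarrow> haros_graph x = G"
  unfolding haros_graph_def using is_haros_graph_unique by blast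

lemma degree_dist_eq:
  assumes "is_haros_graph x G"
  shows "degree_dist k x =
    of_nat (interior_count G k + (if first_degree G + last_degree G = k then 1 else 0))
    / of_int (denom x)"
proof -
  have "(of_nat (node_count G - 1) :: rat) = of_int (denom x)"
    using is_haros_graph_node_count[OF assms] by (metis of_int_of_nat_eq)
  then show ?thesis
    unfolding degree_dist_def haros_graph_eq[OF assms]
      closed_degree_count[OF is_haros_graph_simple[OF assms]]
    by (simp add: closed_nodes_def)
qed

theorem theorem11:
  fixes x :: rat and k :: nat
  assumes "0 \<le> x" and "x \<le> 1" and "5 \<le> k"
  shows "degree_dist (k + 1) (F_map x) = 1 / (1 + x) * degree_dist k x"
proof -
  obtain G where G: "is_haros_graph x G"
    using haros_graph_well_defined[OF assms(1,2)] by blast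
  obtain G' where G': "is_haros_graph (F_map x) G'"
    "first_degree G' = first_degree G + (if x = 1 then 1 else 0)"
    "last_degree G' = last_degree G + (if x = 0 then 0 else 1)"
    "\<And>k. 5 \<le> k \<Longrightarrow> interior_count G' (k + 1) = interior_count G k"
    using is_haros_graph_F_map[OF G] by blast
  have "first_degree G' + last_degree G' = k + 1 \<longleftrightarrow> first_degree G + last_degree G = k"
  proof (cases "x = 0 \<or> x = 1")
    case True
    then have "G = haros_base" using G is_haros_graph_0 is_haros_graph_1 by blast
    \<comment> \<open>The boundary degree is 2 and becomes 2 or 4, below the range of
      \<open>k\<close> and \<open>k + 1\<close>.\<close>
    then show ?thesis using G'(2,3) assms(3) by (simp add: base_degrees)
  next
    case False
    then show ?thesis using G'(2,3) by simp
  qed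
  \<comment> \<open>The numbers of nodes counted agree, so only the totals \<open>denom x\<close>
    and \<open>denom (F_map x)\<close> differ.\<close>
  then have "degree_dist (k + 1) (F_map x) = degree_dist k x * of_int (denom x) / of_int (denom (F_map x))"
    unfolding degree_dist_eq[OF G] degree_dist_eq[OF G'(1)] using G'(4)[OF assms(3)] denom_pos[of x]
    by simp
  also have "of_int (denom (F_map x)) = (1 + x) * of_int (denom x)"
  proof -
    have "of_int (numer x) = x * of_int (denom x)"
      using denom_pos[of x] by (subst (2) rat_numer_denom) simp
    then show ?thesis by (simp add: numer_denom_F_map[OF assms(1)] algebra_simps)
  qed
  finally show ?thesis using denom_pos[of x] by simp
qed

end
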